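(* Work in the ring of formal power series over $\mathbb{Q}$ in the variables $t_2, t_3, t_4, \ldots$ and $v, e, f$. Let $$h(\alpha) = 1 - \alpha + \sum_{n \ge 2} t_n v^{n-1} e^{n} f\, \alpha^n, \qquad \beta = \sum_{\mathbf{m} \ge 0} C_{\mathbf{m}}\, v^{V_{\mathbf{m}}-2} e^{E_{\mathbf{m}}-1} f^{F_{\mathbf{m}}}\, \mathbf{t}^{\mathbf{m}}.$$ Then $h(\beta) = 0$.
   Context: A type is a vector $\mathbf{m} = [m_2, m_3, m_4, \ldots]$ of nonnegative integers with only finitely many nonzero entries; the sum over $\mathbf{m} \ge 0$ ranges over all types. Write $\mathbf{t}^{\mathbf{m}} = \prod_{k\ge 2} t_k^{m_k}$ and $\mathbf{m}! = \prod_{k \ge 2} m_k!$. Define $V_{\mathbf{m}} = 2 + \sum_{k\ge 2}(k-1)m_k$, $E_{\mathbf{m}} = 1 + \sum_{k \ge 2} k\, m_k$, $F_{\mathbf{m}} = \sum_{k\ge 2} m_k$, and the hyper-Catalan numbers $C_{\mathbf{m}} = \dfrac{(E_{\mathbf{m}}-1)!}{(V_{\mathbf{m}}-1)!\,\mathbf{m}!}$. (The composition $h(\beta)$ is a well-defined formal power series since each term $t_n v^{n-1}e^n f \beta^n$ is divisible by $t_n$.) *)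

theory Defs
  imports Complex_Main "HOL-Library.Poly_Mapping"
begin

section \<open>Formal power series in an arbitrary set of variables\<close>

text \<open>
  A monomial in variables from \<open>'v\<close> is a finitely supported exponent vector \<open>'v \<Rightarrow>\<^sub>0 nat\<close>; a formal
  power series assigns a coefficient to every monomial, with no restriction on the support.
  The variable type may be infinite.
\<close>

typedef ('v, 'a) mfps = "UNIV :: (('v \<Rightarrow>\<^sub>0 nat) \<Rightarrow> 'a) set"
  morphisms mfps_nth Abs_mfps by simp

lemma mfps_nth_Abs [simp]: "mfps_nth (Abs_mfps g) \<mu> = g \<mu>"
  by (simp add: Abs_mfps_inverse)

lemma mfps_eqI: "(\<And>\<mu>. mfps_nth f \<mu> = mfps_nth g \<mu>) \<Longrightarrow> f = g"
  by (metis ext mfps_nth_inject)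

lemma finite_le_monomials: "finite {\<alpha>. \<exists>\<beta>. \<alpha> + \<beta> = (\<mu> :: 'v \<Rightarrow>\<^sub>0 nat)}" (is "finite ?S")
proof -
  let ?F = "{g. \<forall>x. (x \<in> Poly_Mapping.keys \<mu> \<longrightarrow> g x \<in> {..Max (Poly_Mapping.lookup \<mu> ` Poly_Mapping.keys \<mu>)}) \<and> (x \<notin> Poly_Mapping.keys \<mu> \<longrightarrow> g x = (0::nat))}"
  have "Poly_Mapping.lookup ` ?S \<subseteq> ?F"
  proof (clarsimp, safe)
    fix \<alpha> \<beta> :: "'v \<Rightarrow>\<^sub>0 nat" and x assume "x \<in> Poly_Mapping.keys (\<alpha> + \<beta>)"
    then have "Poly_Mapping.lookup (\<alpha> + \<beta>) x \<le> Max (Poly_Mapping.lookup (\<alpha> + \<beta>) ` Poly_Mapping.keys (\<alpha> + \<beta>))" by simp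
    then show "Poly_Mapping.lookup \<alpha> x \<le> Max (Poly_Mapping.lookup (\<alpha> + \<beta>) ` Poly_Mapping.keys (\<alpha> + \<beta>))" by (simp add: lookup_add)
  next
    fix \<alpha> \<beta> :: "'v \<Rightarrow>\<^sub>0 nat" and x assume "x \<notin> Poly_Mapping.keys (\<alpha> + \<beta>)"
    then show "Poly_Mapping.lookup \<alpha> x = 0" by (simp add: in_keys_iff lookup_add)
  qed
  moreover have "finite ?F" by (rule finite_set_of_finite_funs) auto
  ultimately have "finite (Poly_Mapping.lookup ` ?S)" by (rule finite_subset)
  then show ?thesis by (rule finite_imageD) (simp add: inj_on_def)
qed

lemma finite_antidiagonal: "finite {(\<alpha>, \<beta>). \<alpha> + \<beta> = (\<mu> :: 'v \<Rightarrow>\<^sub>0 nat)}"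
proof (rule finite_subset)
  let ?S = "{\<alpha>. \<exists>\<beta>. \<alpha> + \<beta> = \<mu>}"
  show "{(\<alpha>, \<beta>). \<alpha> + \<beta> = \<mu>} \<subseteq> ?S \<times> ?S" by (auto, metis add.commute)
  show "finite (?S \<times> ?S)" by (intro finite_cartesian_product finite_le_monomials)
qed

instantiation mfps :: (type, comm_ring_1) comm_ring_1
begin

definition zero_mfps :: "('a, 'b) mfps" where
  "0 = Abs_mfps (\<lambda>\<mu>. 0)"

definition one_mfps :: "('a, 'b) mfps" where
  "1 = Abs_mfps (\<lambda>\<mu>. if \<mu> = 0 then 1 else 0)"

definition plus_mfps :: "('a, 'b) mfps \<Rightarrow> ('a, 'b) mfps \<Rightarrow> ('a, 'b) mfps" where
  "f + g = Abs_mfps (\<lambda>\<mu>. mfps_nth f \<mu> + mfps_nth g \<mu>)"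

definition uminus_mfps :: "('a, 'b) mfps \<Rightarrow> ('a, 'b) mfps" where
  "- f = Abs_mfps (\<lambda>\<mu>. - mfps_nth f \<mu>)"

definition minus_mfps :: "('a, 'b) mfps \<Rightarrow> ('a, 'b) mfps \<Rightarrow> ('a, 'b) mfps" where
  "f - g = Abs_mfps (\<lambda>\<mu>. mfps_nth f \<mu> - mfps_nth g \<mu>)"

definition times_mfps :: "('a, 'b) mfps \<Rightarrow> ('a, 'b) mfps \<Rightarrow> ('a, 'b) mfps" where
  "f * g = Abs_mfps (\<lambda>\<mu>. \<Sum>(\<alpha>, \<beta>) | \<alpha> + \<beta> = \<mu>. mfps_nth f \<alpha> * mfps_nth g \<beta>)"

instance
proof
  fix f g h :: "('a, 'b) mfps"
  show "f * g * h = f * (g * h)"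
  proof (rule mfps_eqI)
    fix \<mu>
    let ?T = "\<lambda>\<alpha> \<beta> \<gamma>. mfps_nth f \<alpha> * mfps_nth g \<beta> * mfps_nth h \<gamma>"
    have "mfps_nth (f * g * h) \<mu> = (\<Sum>(\<delta>, \<gamma>) | \<delta> + \<gamma> = \<mu>. \<Sum>(\<alpha>, \<beta>) | \<alpha> + \<beta> = \<delta>. ?T \<alpha> \<beta> \<gamma>)"
      by (simp add: times_mfps_def sum_distrib_right case_prod_unfold)
    also have "\<dots> = (\<Sum>(p, q) \<in> (SIGMA p:{(\<delta>, \<gamma>). \<delta> + \<gamma> = \<mu>}. {(\<alpha>, \<beta>). \<alpha> + \<beta> = fst p}).
                      ?T (fst q) (snd q) (snd p))"
      by (simp add: case_prod_unfold sum.Sigma finite_antidiagonal[unfolded case_prod_unfold])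
    also have "\<dots> = (\<Sum>(p, q) \<in> (SIGMA p:{(\<alpha>, \<epsilon>). \<alpha> + \<epsilon> = \<mu>}. {(\<beta>, \<gamma>). \<beta> + \<gamma> = snd p}).
                      ?T (fst p) (fst q) (snd q))"
      by (rule sum.reindex_bij_witness
            [where i = "\<lambda>((\<alpha>, \<epsilon>), (\<beta>, \<gamma>)). ((\<alpha> + \<beta>, \<gamma>), (\<alpha>, \<beta>))"
               and j = "\<lambda>((\<delta>, \<gamma>), (\<alpha>, \<beta>)). ((\<alpha>, \<beta> + \<gamma>), (\<beta>, \<gamma>))"])
        (auto simp: add.assoc)
    also have "\<dots> = (\<Sum>(\<alpha>, \<epsilon>) | \<alpha> + \<epsilon> = \<mu>. \<Sum>(\<beta>, \<gamma>) | \<beta> + \<gamma> = \<epsilon>. ?T \<alpha> \<beta> \<gamma>)"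
      by (simp add: case_prod_unfold sum.Sigma finite_antidiagonal[unfolded case_prod_unfold])
    also have "\<dots> = mfps_nth (f * (g * h)) \<mu>"
      by (simp add: times_mfps_def sum_distrib_left case_prod_unfold mult.assoc)
    finally show "mfps_nth (f * g * h) \<mu> = mfps_nth (f * (g * h)) \<mu>" .
  qed
  show "f * g = g * f"
  proof (rule mfps_eqI)
    fix \<mu>
    show "mfps_nth (f * g) \<mu> = mfps_nth (g * f) \<mu>"
      unfolding times_mfps_def mfps_nth_Abs
      by (rule sum.reindex_bij_witness[where i = prod.swap and j = prod.swap])
        (auto simp: add.commute mult.commute)
  qed
  show "1 * f = f"
  proof (rule mfps_eqI)
    fix \<mu>
    have "mfps_nth (1 * f) \<mu> = (\<Sum>(\<alpha>, \<beta>) | \<alpha> + \<beta> = \<mu>. (if \<alpha> = 0 then 1 else 0) * mfps_nth f \<beta>)"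
      by (simp add: times_mfps_def one_mfps_def)
    also have "\<dots> = (\<Sum>(\<alpha>, \<beta>) \<in> {(0 :: 'a \<Rightarrow>\<^sub>0 nat, \<mu>)}. (if \<alpha> = 0 then 1 else 0) * mfps_nth f \<beta>)"
      by (rule sum.mono_neutral_right[OF finite_antidiagonal]) (auto split: if_splits)
    finally show "mfps_nth (1 * f) \<mu> = mfps_nth f \<mu>" by simp
  qed
  show "(f + g) * h = f * h + g * h"
    by (rule mfps_eqI)
      (simp add: times_mfps_def plus_mfps_def distrib_right sum.distrib case_prod_unfold)
  show "f + g + h = f + (g + h)" "f + g = g + f" "0 + f = f" "- f + f = 0" "f - g = f + - g"
    by (auto intro!: mfps_eqI simp: plus_mfps_def zero_mfps_def uminus_mfps_def minus_mfps_def)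
  show "(0 :: ('a, 'b) mfps) \<noteq> 1"
  proof
    assume "(0 :: ('a, 'b) mfps) = 1"
    then have "mfps_nth (0 :: ('a, 'b) mfps) 0 = mfps_nth 1 0" by simp
    then show False by (simp add: zero_mfps_def one_mfps_def)
  qed
qed

end

definition mfps_monom :: "('v \<Rightarrow>\<^sub>0 nat) \<Rightarrow> 'a \<Rightarrow> ('v, 'a::comm_ring_1) mfps" where
  "mfps_monom \<mu> c = Abs_mfps (\<lambda>\<nu>. if \<nu> = \<mu> then c else 0)"

definition mfps_const :: "'a \<Rightarrow> ('v, 'a::comm_ring_1) mfps" where
  "mfps_const c = mfps_monom 0 c"

definition mfps_var :: "'v \<Rightarrow> ('v, 'a::comm_ring_1) mfps" where
  "mfps_var x = mfps_monom (Poly_Mapping.single x 1) 1"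

text \<open>
  A family of formal power series has a formal sum iff every monomial occurs in only finitely many
  members; the sum is then taken coefficientwise. For families without this property
  \<open>mfps_sum\<close> is a junk value.
\<close>

definition mfps_summable :: "('i \<Rightarrow> ('v, 'a::comm_ring_1) mfps) \<Rightarrow> 'i set \<Rightarrow> bool" where
  "mfps_summable F I \<longleftrightarrow> (\<forall>\<mu>. finite {i \<in> I. mfps_nth (F i) \<mu> \<noteq> 0})"

definition mfps_sum :: "('i \<Rightarrow> ('v, 'a::comm_ring_1) mfps) \<Rightarrow> 'i set \<Rightarrow> ('v, 'a) mfps" where
  "mfps_sum F I = Abs_mfps (\<lambda>\<mu>. \<Sum>i | i \<in> I \<and> mfps_nth (F i) \<mu> \<noteq> 0. mfps_nth (F i) \<mu>)"

lemma mfps_sum_finite: "finite I \<Longrightarrow> mfps_sum F I = sum F I"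
proof (rule mfps_eqI)
  fix \<mu> assume fin: "finite I"
  have "mfps_nth (sum F I) \<mu> = (\<Sum>i\<in>I. mfps_nth (F i) \<mu>)"
    using fin by (induction I) (auto simp: zero_mfps_def plus_mfps_def)
  also have "\<dots> = (\<Sum>i | i \<in> I \<and> mfps_nth (F i) \<mu> \<noteq> 0. mfps_nth (F i) \<mu>)"
    by (rule sum.mono_neutral_right) (use fin in auto)
  finally show "mfps_nth (mfps_sum F I) \<mu> = mfps_nth (sum F I) \<mu>" by (simp add: mfps_sum_def)
qed

lemma mfps_monom_mult: "mfps_monom \<mu> c * mfps_monom \<nu> d = mfps_monom (\<mu> + \<nu>) (c * d)"
proof (rule mfps_eqI)
  fix \<kappa>
  have "mfps_nth (mfps_monom \<mu> c * mfps_monom \<nu> d) \<kappa> =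
      (\<Sum>(\<alpha>, \<beta>) | \<alpha> + \<beta> = \<kappa>. (if \<alpha> = \<mu> then c else 0) * (if \<beta> = \<nu> then d else 0))"
    by (simp add: times_mfps_def mfps_monom_def)
  also have "\<dots> = (\<Sum>(\<alpha>, \<beta>) \<in> (if \<mu> + \<nu> = \<kappa> then {(\<mu>, \<nu>)} else {}).
                    (if \<alpha> = \<mu> then c else 0) * (if \<beta> = \<nu> then d else 0))"
    by (rule sum.mono_neutral_right[OF finite_antidiagonal]) (auto split: if_splits)
  also have "\<dots> = mfps_nth (mfps_monom (\<mu> + \<nu>) (c * d)) \<kappa>" by (auto simp: mfps_monom_def)
  finally show "mfps_nth (mfps_monom \<mu> c * mfps_monom \<nu> d) \<kappa> = mfps_nth (mfps_monom (\<mu> + \<nu>) (c * d)) \<kappa>" .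
qed

lemma mfps_monom_one: "mfps_monom 0 1 = 1"
  by (simp add: mfps_monom_def one_mfps_def)

lemma mfps_var_power: "mfps_var x ^ n = mfps_monom (Poly_Mapping.single x n) 1"
  by (induction n) (simp_all add: mfps_monom_one mfps_var_def mfps_monom_mult flip: single_add)

lemma mfps_monom_prod: "finite A \<Longrightarrow> (\<Prod>k\<in>A. mfps_monom (g k) 1) = mfps_monom (\<Sum>k\<in>A. g k) 1"
  by (induction A rule: finite_induct) (simp_all add: mfps_monom_one mfps_monom_mult)

lemma mfps_nth_var_mult_nonzero:
  assumes "mfps_nth (mfps_var x * g) \<mu> \<noteq> 0"
  shows "x \<in> Poly_Mapping.keys \<mu>"
proof (rule ccontr)
  assume nin: "x \<notin> Poly_Mapping.keys \<mu>"
  have "(case p of (\<alpha>, \<beta>) \<Rightarrow> mfps_nth (mfps_var x) \<alpha> * mfps_nth g \<beta>) = 0"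
    if "p \<in> {(\<alpha>, \<beta>). \<alpha> + \<beta> = \<mu>}" for p
    using that nin by (auto simp: mfps_var_def mfps_monom_def in_keys_iff lookup_add)
  then have "mfps_nth (mfps_var x * g) \<mu> = 0" by (simp add: times_mfps_def sum.neutral)
  with assms show False by simp
qed

section \<open>The series \<open>h\<close> and \<open>\<beta>\<close>\<close>

text \<open>The variable \<open>t\<^sub>n\<close>, \<open>n \<ge> 2\<close>, is \<open>TVar (n - 2)\<close>, so there are no superfluous \<open>t\<^sub>0\<close>, \<open>t\<^sub>1\<close>.\<close>

datatype var = TVar nat | VVar | EVar | FVar

type_synonym series = "(var, rat) mfps"

definition t_var :: "nat \<Rightarrow> series" where "t_var n = mfps_var (TVar (n - 2))"
definition v_var :: series where "v_var = mfps_var VVar"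
definition e_var :: series where "e_var = mfps_var EVar"
definition f_var :: series where "f_var = mfps_var FVar"

definition types :: "(nat \<Rightarrow>\<^sub>0 nat) set" where
  "types = {m. Poly_Mapping.keys m \<subseteq> {2..}}"

definition V_num :: "(nat \<Rightarrow>\<^sub>0 nat) \<Rightarrow> nat" where
  "V_num m = 2 + (\<Sum>k\<in>Poly_Mapping.keys m. (k - 1) * Poly_Mapping.lookup m k)"

definition E_num :: "(nat \<Rightarrow>\<^sub>0 nat) \<Rightarrow> nat" where
  "E_num m = 1 + (\<Sum>k\<in>Poly_Mapping.keys m. k * Poly_Mapping.lookup m k)"

definition F_num :: "(nat \<Rightarrow>\<^sub>0 nat) \<Rightarrow> nat" where
  "F_num m = (\<Sum>k\<in>Poly_Mapping.keys m. Poly_Mapping.lookup m k)"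

definition type_fact :: "(nat \<Rightarrow>\<^sub>0 nat) \<Rightarrow> nat" where
  "type_fact m = (\<Prod>k\<in>Poly_Mapping.keys m. fact (Poly_Mapping.lookup m k))"

definition hyper_catalan :: "(nat \<Rightarrow>\<^sub>0 nat) \<Rightarrow> rat" where
  "hyper_catalan m = fact (E_num m - 1) / (fact (V_num m - 1) * of_nat (type_fact m))"

definition t_pow :: "(nat \<Rightarrow>\<^sub>0 nat) \<Rightarrow> series" where
  "t_pow m = (\<Prod>k\<in>Poly_Mapping.keys m. t_var k ^ Poly_Mapping.lookup m k)"

definition h_term :: "series \<Rightarrow> nat \<Rightarrow> series" where
  "h_term \<alpha> n = t_var n * v_var ^ (n - 1) * e_var ^ n * f_var * \<alpha> ^ n"

definition h :: "series \<Rightarrow> series" where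
  "h \<alpha> = 1 - \<alpha> + mfps_sum (h_term \<alpha>) {2..}"

definition beta_term :: "(nat \<Rightarrow>\<^sub>0 nat) \<Rightarrow> series" where
  "beta_term m = mfps_const (hyper_catalan m) *
     v_var ^ (V_num m - 2) * e_var ^ (E_num m - 1) * f_var ^ F_num m * t_pow m"

definition beta :: series where
  "beta = mfps_sum beta_term types"

text \<open>Both formal sums are well defined.\<close>

lemma h_term_summable: "mfps_summable (h_term \<alpha>) {2..}"
  unfolding mfps_summable_def
proof
  fix \<mu> :: "var \<Rightarrow>\<^sub>0 nat"
  have "TVar (n - 2) \<in> Poly_Mapping.keys \<mu>" if "mfps_nth (h_term \<alpha> n) \<mu> \<noteq> 0" for n
    using that unfolding h_term_def t_var_def mult.assoc by (rule mfps_nth_var_mult_nonzero)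
  then have "(\<lambda>n. TVar (n - 2)) ` {n \<in> {2..}. mfps_nth (h_term \<alpha> n) \<mu> \<noteq> 0} \<subseteq> Poly_Mapping.keys \<mu>" by auto
  then have "finite ((\<lambda>n. TVar (n - 2)) ` {n \<in> {2..}. mfps_nth (h_term \<alpha> n) \<mu> \<noteq> 0})"
    by (rule finite_subset) simp
  then show "finite {n \<in> {2..}. mfps_nth (h_term \<alpha> n) \<mu> \<noteq> 0}"
    by (rule finite_imageD) (auto simp: inj_on_def)
qed

lemma t_pow_monom:
  "t_pow m = mfps_monom (\<Sum>k\<in>Poly_Mapping.keys m. Poly_Mapping.single (TVar (k - 2)) (Poly_Mapping.lookup m k)) 1"
  by (simp add: t_pow_def t_var_def mfps_var_power mfps_monom_prod)

lemma beta_term_summable: "mfps_summable beta_term types"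
  unfolding mfps_summable_def
proof
  fix \<mu> :: "var \<Rightarrow>\<^sub>0 nat"
  have *: "Poly_Mapping.lookup m k = (if k \<ge> 2 then Poly_Mapping.lookup \<mu> (TVar (k - 2)) else 0)"
    if m: "m \<in> types" and nz: "mfps_nth (beta_term m) \<mu> \<noteq> 0" for m k
  proof (cases "k \<ge> 2")
    case False
    then have "k \<notin> Poly_Mapping.keys m" using m by (auto simp: types_def)
    with False show ?thesis by (simp add: in_keys_iff)
  next
    case True
    have \<mu>: "\<mu> = Poly_Mapping.single VVar (V_num m - 2) + Poly_Mapping.single EVar (E_num m - 1)
        + Poly_Mapping.single FVar (F_num m)
        + (\<Sum>j\<in>Poly_Mapping.keys m. Poly_Mapping.single (TVar (j - 2)) (Poly_Mapping.lookup m j))"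
      using nz unfolding beta_term_def v_var_def e_var_def f_var_def
      by (simp add: mfps_const_def mfps_var_power t_pow_monom mfps_monom_mult)
        (simp add: mfps_monom_def split: if_splits)
    have "Poly_Mapping.lookup \<mu> (TVar (k - 2)) = (\<Sum>j\<in>Poly_Mapping.keys m. Poly_Mapping.lookup m j when TVar (j - 2) = TVar (k - 2))"
      unfolding \<mu> by (simp add: lookup_add lookup_sum lookup_single)
    also have "\<dots> = (\<Sum>j\<in>Poly_Mapping.keys m. if j = k then Poly_Mapping.lookup m j else 0)"
      using m True by (intro sum.cong) (auto simp: types_def when_def)
    also have "\<dots> = Poly_Mapping.lookup m k" by (simp add: in_keys_iff)
    finally show ?thesis using True by simp
  qed
  have "m = m'" if "m \<in> types" "mfps_nth (beta_term m) \<mu> \<noteq> 0"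
      "m' \<in> types" "mfps_nth (beta_term m') \<mu> \<noteq> 0" for m m'
    using that by (intro poly_mapping_eqI) (simp add: *)
  then have "\<exists>m\<^sub>0. {m \<in> types. mfps_nth (beta_term m) \<mu> \<noteq> 0} \<subseteq> {m\<^sub>0}" by blast
  then show "finite {m \<in> types. mfps_nth (beta_term m) \<mu> \<noteq> 0}"
    using finite_subset by blast
qed

end

theory Submission
  imports Defs
begin

text \<open>
  Write \<open>\<tau>\<^sub>n = t\<^sub>n v\<^bsup>n-1\<^esup> e\<^sup>n f\<close>, so that the theorem reads \<open>\<beta> = 1 + \<Sum>\<^sub>n \<tau>\<^sub>n \<beta>\<^sup>n\<close>. The coefficients of \<open>\<beta>\<^sup>r\<close> are
  guessed to be the Raney numbers \<open>r (r + E - 2)! / ((r + V - 2)! m!)\<close>. If \<open>B\<^sub>r\<close> is the series with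
  these coefficients, a direct computation gives \<open>B\<^sub>0 = 1\<close> and
  \<open>B\<^bsub>r+1\<^esub> = B\<^sub>r + \<Sum>\<^sub>n \<tau>\<^sub>n B\<^bsub>r+n\<^esub>\<close>. This linear recurrence has a unique solution with given initial
  value, by induction on the degree in \<open>f\<close> and then on \<open>r\<close>. Both \<open>B\<^sub>r B\<^sub>s\<close> and \<open>B\<^bsub>r+s\<^esub>\<close> solve it as
  sequences in \<open>r\<close> with initial value \<open>B\<^sub>s\<close>, so \<open>B\<^sub>r = B\<^sub>1\<^sup>r = \<beta>\<^sup>r\<close>, and the case \<open>r = 0\<close> of the
  recurrence is the claim.
\<close>

declare One_nat_def [simp del]

section \<open>Coefficients of formal sums and of products with monomials\<close>

lemma mfps_nth_simps [simp]:
  "mfps_nth 0 \<mu> = 0"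
  "mfps_nth 1 \<mu> = (if \<mu> = 0 then 1 else 0)"
  "mfps_nth (f + g) \<mu> = mfps_nth f \<mu> + mfps_nth g \<mu>"
  "mfps_nth (f - g) \<mu> = mfps_nth f \<mu> - mfps_nth g \<mu>"
  "mfps_nth (mfps_monom \<nu> c) \<mu> = (if \<mu> = \<nu> then c else 0)"
  by (simp_all add: zero_mfps_def one_mfps_def plus_mfps_def minus_mfps_def mfps_monom_def)

lemma mfps_nth_mult:
  "mfps_nth (f * g) \<mu> = (\<Sum>(\<alpha>, \<beta>) | \<alpha> + \<beta> = \<mu>. mfps_nth f \<alpha> * mfps_nth g \<beta>)"
  by (simp add: times_mfps_def)

text \<open>\<open>mfps_sum\<close> adds over the exact support at \<mu>, which varies with the
  family; a common finite superset lets different families be compared termwise.\<close>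

lemma mfps_nth_sum_superset:
  assumes "finite J" "J \<subseteq> I" "\<And>i. i \<in> I \<Longrightarrow> mfps_nth (F i) \<mu> \<noteq> 0 \<Longrightarrow> i \<in> J"
  shows "mfps_nth (mfps_sum F I) \<mu> = (\<Sum>i\<in>J. mfps_nth (F i) \<mu>)"
  unfolding mfps_sum_def mfps_nth_Abs
  by (rule sum.mono_neutral_left) (use assms in auto)

lemma mfps_sum_diff:
  assumes "mfps_summable F I" "mfps_summable G I"
  shows "mfps_sum (\<lambda>i. F i - G i) I = mfps_sum F I - mfps_sum G I"
proof (rule mfps_eqI)
  fix \<mu>
  define J where "J = {i \<in> I. mfps_nth (F i) \<mu> \<noteq> 0} \<union> {i \<in> I. mfps_nth (G i) \<mu> \<noteq> 0}"
  have J: "finite J" "J \<subseteq> I" using assms by (auto simp: J_def mfps_summable_def)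
  have "mfps_nth (mfps_sum H I) \<mu> = (\<Sum>i\<in>J. mfps_nth (H i) \<mu>)"
    if "H \<in> {F, G, \<lambda>i. F i - G i}" for H
    by (rule mfps_nth_sum_superset[OF J]) (use that in \<open>auto simp: J_def\<close>)
  then show "mfps_nth (mfps_sum (\<lambda>i. F i - G i) I) \<mu> = mfps_nth (mfps_sum F I - mfps_sum G I) \<mu>"
    by (simp add: sum_subtractf)
qed

lemma mfps_sum_mult_right:
  assumes "mfps_summable F I"
  shows "mfps_sum F I * g = mfps_sum (\<lambda>i. F i * g) I"
proof (rule mfps_eqI)
  fix \<mu>
  \<comment> \<open>Only the finitely many divisors \<alpha> of \<mu> enter a product coefficient,
    so one finite index set serves all of them.\<close>
  define J where "J = (\<Union>\<alpha>\<in>{\<alpha>. \<exists>\<beta>. \<alpha> + \<beta> = \<mu>}. {i \<in> I. mfps_nth (F i) \<alpha> \<noteq> 0})"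
  have J: "finite J" "J \<subseteq> I"
    using assms finite_le_monomials[of \<mu>] by (auto simp: J_def mfps_summable_def)
  have F: "mfps_nth (mfps_sum F I) \<alpha> = (\<Sum>i\<in>J. mfps_nth (F i) \<alpha>)" if "\<alpha> + \<beta> = \<mu>" for \<alpha> \<beta>
    by (rule mfps_nth_sum_superset[OF J]) (use that in \<open>auto simp: J_def\<close>)
  have supp: "i \<in> J" if "i \<in> I" "mfps_nth (F i * g) \<mu> \<noteq> 0" for i
  proof (rule ccontr)
    assume "i \<notin> J"
    then have "mfps_nth (F i) \<alpha> = 0" if "\<alpha> + \<beta> = \<mu>" for \<alpha> \<beta>
      using that \<open>i \<in> I\<close> by (auto simp: J_def)
    then have "mfps_nth (F i * g) \<mu> = 0"
      unfolding mfps_nth_mult by (intro sum.neutral) auto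
    with that show False by simp
  qed
  have "mfps_nth (mfps_sum F I * g) \<mu> =
      (\<Sum>(\<alpha>, \<beta>) | \<alpha> + \<beta> = \<mu>. \<Sum>i\<in>J. mfps_nth (F i) \<alpha> * mfps_nth g \<beta>)"
    unfolding mfps_nth_mult by (rule sum.cong) (auto simp: F sum_distrib_right)
  also have "\<dots> = (\<Sum>i\<in>J. mfps_nth (F i * g) \<mu>)"
    unfolding mfps_nth_mult case_prod_unfold by (rule sum.swap)
  also have "\<dots> = mfps_nth (mfps_sum (\<lambda>i. F i * g) I) \<mu>"
    by (rule mfps_nth_sum_superset[OF J supp, symmetric])
  finally show "mfps_nth (mfps_sum F I * g) \<mu> = mfps_nth (mfps_sum (\<lambda>i. F i * g) I) \<mu>" .
qed

lemma mfps_nth_monom_mult_add: "mfps_nth (mfps_monom \<tau> c * g) (\<tau> + \<nu>) = c * mfps_nth g \<nu>"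
proof -
  have "mfps_nth (mfps_monom \<tau> c * g) (\<tau> + \<nu>) =
      (\<Sum>(\<alpha>, \<beta>) \<in> {(\<tau>, \<nu>)}. mfps_nth (mfps_monom \<tau> c) \<alpha> * mfps_nth g \<beta>)"
    unfolding mfps_nth_mult
    by (rule sum.mono_neutral_right[OF finite_antidiagonal]) (auto split: if_splits)
  then show ?thesis by simp
qed

lemma mfps_nth_monom_mult_nonzero:
  assumes "mfps_nth (mfps_monom \<tau> c * g) \<mu> \<noteq> 0"
  obtains \<nu> where "\<mu> = \<tau> + \<nu>"
proof -
  have "\<exists>\<nu>. \<mu> = \<tau> + \<nu>"
  proof (rule ccontr)
    assume "\<nexists>\<nu>. \<mu> = \<tau> + \<nu>"
    then have "mfps_nth (mfps_monom \<tau> c * g) \<mu> = 0"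
      unfolding mfps_nth_mult by (intro sum.neutral) (auto split: if_splits)
    with assms show False by simp
  qed
  with that show thesis by blast
qed

section \<open>Edge, vertex and face counts of a type\<close>

definition edge_sum :: "(nat \<Rightarrow>\<^sub>0 nat) \<Rightarrow> nat" where
  "edge_sum m = (\<Sum>k\<in>Poly_Mapping.keys m. k * Poly_Mapping.lookup m k)"

definition vertex_sum :: "(nat \<Rightarrow>\<^sub>0 nat) \<Rightarrow> nat" where
  "vertex_sum m = (\<Sum>k\<in>Poly_Mapping.keys m. (k - 1) * Poly_Mapping.lookup m k)"

text \<open>Without the constants 1 and 2 of \<open>E_num\<close> and \<open>V_num\<close> the
  counts become additive.\<close>

lemma edge_sum_add: "edge_sum (m + m') = edge_sum m + edge_sum m'"
  unfolding edge_sum_def by (rule setsum_keys_plus_distrib) (simp_all add: distrib_left)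

lemma vertex_sum_add: "vertex_sum (m + m') = vertex_sum m + vertex_sum m'"
  unfolding vertex_sum_def by (rule setsum_keys_plus_distrib) (simp_all add: distrib_left)

lemma F_num_add: "F_num (m + m') = F_num m + F_num m'"
  unfolding F_num_def by (rule setsum_keys_plus_distrib) simp_all

lemma sums_single [simp]:
  "edge_sum (Poly_Mapping.single n c) = n * c"
  "vertex_sum (Poly_Mapping.single n c) = (n - 1) * c"
  "F_num (Poly_Mapping.single n c) = c"
  by (cases "c = 0"; simp add: edge_sum_def vertex_sum_def F_num_def)+

text \<open>Euler's relation V - E + F = 1 without its constants. As \<open>k - 1\<close> is
  truncated, \<open>k \<ge> 1\<close> on the keys is what makes it hold termwise.\<close>

lemma edge_sum_eq_vertex_sum: "m \<in> types \<Longrightarrow> edge_sum m = vertex_sum m + F_num m"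
  unfolding edge_sum_def vertex_sum_def F_num_def sum.distrib[symmetric]
proof (rule sum.cong[OF refl])
  fix k assume "m \<in> types" "k \<in> Poly_Mapping.keys m"
  then have "1 \<le> k" by (auto simp: types_def)
  then show "k * Poly_Mapping.lookup m k = (k - 1) * Poly_Mapping.lookup m k + Poly_Mapping.lookup m k"
    by (cases k) auto
qed

lemma edge_sum_pos:
  assumes "m \<in> types" "m \<noteq> 0"
  shows "edge_sum m \<ge> 1"
proof -
  obtain k where k: "k \<in> Poly_Mapping.keys m" using assms(2) by (meson all_not_in_conv keys_eq_empty)
  then have "k * Poly_Mapping.lookup m k \<le> edge_sum m"
    unfolding edge_sum_def by (intro member_le_sum) auto
  moreover have "k \<ge> 2" "Poly_Mapping.lookup m k \<ge> 1"
    using k assms(1) lookup_not_eq_zero_eq_in_keys[of m k] by (auto simp: types_def)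
  then have "1 * 1 \<le> k * Poly_Mapping.lookup m k" by (intro mult_le_mono) auto
  ultimately show ?thesis by simp
qed

section \<open>The monomial of a type\<close>

definition type_monom :: "(nat \<Rightarrow>\<^sub>0 nat) \<Rightarrow> (var \<Rightarrow>\<^sub>0 nat)" where
  "type_monom m = Poly_Mapping.single VVar (vertex_sum m) + Poly_Mapping.single EVar (edge_sum m)
     + Poly_Mapping.single FVar (F_num m)
     + (\<Sum>k\<in>Poly_Mapping.keys m. Poly_Mapping.single (TVar (k - 2)) (Poly_Mapping.lookup m k))"

text \<open>Adding a face \<open>n\<close> to a type thus multiplies its monomial by
  \<open>\<tau>\<^sub>n\<close>, whose exponent vector is that of the type with the single face
  \<open>n\<close>.\<close>

lemma type_monom_add: "type_monom (m + m') = type_monom m + type_monom m'"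
proof -
  have "(\<Sum>k\<in>Poly_Mapping.keys (m + m'). Poly_Mapping.single (TVar (k - 2)) (Poly_Mapping.lookup (m + m') k)) =
      (\<Sum>k\<in>Poly_Mapping.keys m. Poly_Mapping.single (TVar (k - 2)) (Poly_Mapping.lookup m k)) +
      (\<Sum>k\<in>Poly_Mapping.keys m'. Poly_Mapping.single (TVar (k - 2)) (Poly_Mapping.lookup m' k))"
    by (rule setsum_keys_plus_distrib) (simp_all add: single_add)
  then show ?thesis
    by (simp add: type_monom_def vertex_sum_add edge_sum_add F_num_add single_add ac_simps)
qed

lemma lookup_type_monom_FVar: "Poly_Mapping.lookup (type_monom m) FVar = F_num m"
  by (simp add: type_monom_def lookup_add lookup_sum lookup_single)

text \<open>The truncated \<open>k - 2\<close> would merge the indices 0, 1 and 2 into one variable;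
  in a type only 2 can occur among them.\<close>

lemma lookup_type_monom_TVar:
  assumes "m \<in> types" "k \<ge> 2"
  shows "Poly_Mapping.lookup (type_monom m) (TVar (k - 2)) = Poly_Mapping.lookup m k"
proof -
  have "Poly_Mapping.lookup (type_monom m) (TVar (k - 2)) =
      (\<Sum>j\<in>Poly_Mapping.keys m. if j = k then Poly_Mapping.lookup m j else 0)"
    unfolding type_monom_def lookup_add lookup_sum lookup_single
    using assms eq_diff_iff[of 2 _ k]
    by (auto simp: types_def when_def simp del: sum.delta sum.delta' intro!: sum.cong)
  then show ?thesis by (simp add: in_keys_iff)
qed

text \<open>The exponents of the \<open>t\<close> variables alone determine the type, so no two
  types contribute to the same coefficient.\<close>

lemma inj_on_type_monom: "inj_on type_monom types"
proof (rule inj_onI, rule poly_mapping_eqI)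
  fix m m' k assume m: "m \<in> types" "m' \<in> types" "type_monom m = type_monom m'"
  show "Poly_Mapping.lookup m k = Poly_Mapping.lookup m' k"
  proof (cases "k \<ge> 2")
    case True
    with m show ?thesis by (metis lookup_type_monom_TVar)
  next
    case False
    with m have "k \<notin> Poly_Mapping.keys m" "k \<notin> Poly_Mapping.keys m'" by (auto simp: types_def)
    then show ?thesis by (simp add: in_keys_iff)
  qed
qed

lemma single_in_types: "n \<ge> 2 \<Longrightarrow> Poly_Mapping.single n c \<in> types"
  by (simp add: types_def)

lemma types_add: "m \<in> types \<Longrightarrow> m' \<in> types \<Longrightarrow> m + m' \<in> types"
  using keys_add[of m m'] by (auto simp: types_def)

section \<open>Uniqueness for the face recurrence\<close>

abbreviation face_monom :: "nat \<Rightarrow> (var \<Rightarrow>\<^sub>0 nat)" where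
  "face_monom n \<equiv> type_monom (Poly_Mapping.single n 1)"

abbreviation face_sum :: "(nat \<Rightarrow> series) \<Rightarrow> series" where
  "face_sum G \<equiv> mfps_sum (\<lambda>n. mfps_monom (face_monom n) 1 * G n) {2..}"

text \<open>The term of \<open>n\<close> is divisible by \<open>t\<^sub>n\<close>, and a monomial
  contains only finitely many variables.\<close>

lemma face_summable: "mfps_summable (\<lambda>n. mfps_monom (face_monom n) 1 * (G n :: series)) {2..}"
  unfolding mfps_summable_def
proof
  fix \<mu> :: "var \<Rightarrow>\<^sub>0 nat"
  let ?S = "{n \<in> {2..}. mfps_nth (mfps_monom (face_monom n) 1 * G n) \<mu> \<noteq> 0}"
  have "TVar (n - 2) \<in> Poly_Mapping.keys \<mu>" if n: "n \<in> ?S" for n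
  proof -
    from n obtain \<nu> where "\<mu> = face_monom n + \<nu>" by (auto elim: mfps_nth_monom_mult_nonzero)
    with n show ?thesis
      using lookup_type_monom_TVar[OF single_in_types, of n n 1] by (simp add: in_keys_iff lookup_add)
  qed
  then have "finite ((\<lambda>n. TVar (n - 2)) ` ?S)"
    by (intro finite_subset[OF _ finite_keys[of \<mu>]]) auto
  then show "finite ?S" by (rule finite_imageD) (auto simp: inj_on_def)
qed

lemma face_recurrence_zero:
  assumes D0: "D 0 = 0" and DS: "\<And>r. D (Suc r) = D r + face_sum (\<lambda>n. D (r + n))"
  shows "D r = 0"
proof -
  have "mfps_nth (D r) \<mu> = 0" if "Poly_Mapping.lookup \<mu> FVar = d" for d \<mu> r
    using that
  \<comment> \<open>\<open>r\<close> stays arbitrary because the recurrence refers to the larger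
    indices \<open>r + n\<close>.\<close>
  proof (induction d arbitrary: \<mu> r rule: less_induct)
    case (less d)
    \<comment> \<open>\<open>face_monom n\<close> has degree 1 in \<open>FVar\<close>, so the
      cofactor has smaller degree and the induction hypothesis covers it at every index.\<close>
    have faces: "mfps_nth (mfps_monom (face_monom n) 1 * D s) \<mu> = 0" for n s
    proof (rule ccontr)
      assume nz: "mfps_nth (mfps_monom (face_monom n) 1 * D s) \<mu> \<noteq> 0"
      then obtain \<nu> where \<nu>: "\<mu> = face_monom n + \<nu>" by (rule mfps_nth_monom_mult_nonzero)
      then have "Poly_Mapping.lookup \<nu> FVar < d"
        using less.prems by (simp add: lookup_add lookup_type_monom_FVar)
      then have "mfps_nth (D s) \<nu> = 0" using less.IH by blast
      with nz show False by (simp add: \<nu> mfps_nth_monom_mult_add)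
    qed
    show ?case by (induction r) (simp_all add: D0 DS mfps_sum_def faces)
  qed
  then show ?thesis by (intro mfps_eqI) simp
qed

section \<open>Raney numbers and their recurrence\<close>

text \<open>The case \<open>m = 0\<close> is separate only because of \<open>r = 0\<close>, where the quotient would give \<open>0\<close> instead of \<open>1\<close>.\<close>

definition raney :: "nat \<Rightarrow> (nat \<Rightarrow>\<^sub>0 nat) \<Rightarrow> rat" where
  "raney r m = (if m = 0 then 1
     else of_nat r * fact (r + edge_sum m - 1) / (fact (r + vertex_sum m) * of_nat (type_fact m)))"

lemma type_fact_zero [simp]: "type_fact 0 = 1"
  by (simp add: type_fact_def)

lemma edge_sum_zero [simp]: "edge_sum 0 = 0"
  by (simp add: edge_sum_def)

lemma vertex_sum_zero [simp]: "vertex_sum 0 = 0"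
  by (simp add: vertex_sum_def)

lemma raney_pos_index:
  assumes "r > 0"
  shows "raney r m = of_nat r * fact (r + edge_sum m - 1) / (fact (r + vertex_sum m) * of_nat (type_fact m))"
  using assms by (cases r) (auto simp: raney_def)

lemma type_fact_add_single:
  "type_fact (m + Poly_Mapping.single n 1) = (Poly_Mapping.lookup m n + 1) * type_fact m"
proof -
  let ?m = "m + Poly_Mapping.single n 1" and ?K = "insert n (Poly_Mapping.keys m)"
  have lk: "Poly_Mapping.lookup ?m k = Poly_Mapping.lookup m k + (if k = n then 1 else 0)" for k
    by (simp add: lookup_add lookup_single when_def)
  have K: "Poly_Mapping.keys ?m = ?K" by (auto simp: in_keys_iff lk split: if_splits)
  have "type_fact ?m = fact (Poly_Mapping.lookup m n + 1) *
      (\<Prod>k\<in>?K - {n}. fact (Poly_Mapping.lookup m k))"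
    unfolding type_fact_def K by (subst prod.remove[of _ n]) (auto simp: lk intro!: prod.cong)
  also have "\<dots> = (Poly_Mapping.lookup m n + 1) * (\<Prod>k\<in>?K. fact (Poly_Mapping.lookup m k))"
    by (subst (2) prod.remove[of _ n]) (auto simp: One_nat_def algebra_simps)
  also have "(\<Prod>k\<in>?K. fact (Poly_Mapping.lookup m k)) = type_fact m"
    unfolding type_fact_def by (rule prod.mono_neutral_right) (auto simp: in_keys_iff)
  finally show ?thesis .
qed

text \<open>The recurrence coefficient by coefficient: each summand removes one face. For
  \<open>m \<noteq> 0\<close> all terms are multiples of a common \<open>Q\<close>, and the
  multipliers satisfy \<open>(r + 1) (r + E) = r (r + P + 1) + (r F + E)\<close> because
  \<open>E = P + F\<close>.\<close>

lemma raney_Suc: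
  assumes m: "m \<in> types"
  shows "raney (Suc r) m = raney r m +
    (\<Sum>n\<in>Poly_Mapping.keys m. raney (r + n) (m - Poly_Mapping.single n 1))"
proof (cases "m = 0")
  case True
  then show ?thesis by (simp add: raney_def)
next
  case False
  define E P where "E = edge_sum m" and "P = vertex_sum m"
  define Q :: rat where "Q = fact (r + E - 1) / (fact (Suc (r + P)) * of_nat (type_fact m))"
  \<comment> \<open>This gives \<open>Suc (r + E - 1) = r + E\<close> even at
    \<open>r = 0\<close>.\<close>
  have E: "E \<ge> 1" using edge_sum_pos[OF m False] by (simp add: E_def)
  have EP: "E = P + F_num m" using edge_sum_eq_vertex_sum[OF m] by (simp add: E_def P_def)
  have face: "raney (r + n) (m - Poly_Mapping.single n 1) = Q * of_nat ((r + n) * Poly_Mapping.lookup m n)"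
    if n: "n \<in> Poly_Mapping.keys m" for n
  proof -
    define m' where "m' = m - Poly_Mapping.single n 1"
    have m_eq: "m = m' + Poly_Mapping.single n 1"
      using n by (intro poly_mapping_eqI)
        (auto simp: m'_def lookup_add lookup_minus lookup_single when_def in_keys_iff)
    have n2: "n \<ge> 2" using n m by (auto simp: types_def)
    have lk: "Poly_Mapping.lookup m n = Poly_Mapping.lookup m' n + 1"
      by (subst m_eq) (simp add: lookup_add)
    have tf: "type_fact m = Poly_Mapping.lookup m n * type_fact m'"
      by (subst m_eq) (simp add: type_fact_add_single lk)
    \<comment> \<open>Removing a face \<open>n\<close> takes \<open>n\<close> from the edge sum and
      \<open>n - 1\<close> from the vertex sum; raising the index by \<open>n\<close> cancels the
      first and leaves a surplus of 1 in the second.\<close>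
    have E': "r + n + edge_sum m' - 1 = r + E - 1"
      unfolding E_def by (subst m_eq) (simp add: edge_sum_add)
    have P': "r + n + vertex_sum m' = Suc (r + P)"
      unfolding P_def using n2 by (subst m_eq) (simp add: vertex_sum_add)
    have "raney (r + n) m' = of_nat (r + n) * fact (r + E - 1) / (fact (Suc (r + P)) * of_nat (type_fact m'))"
      using n2 raney_pos_index[of "r + n" m'] by (simp only: E' P')
    also have "\<dots> = Q * of_nat ((r + n) * Poly_Mapping.lookup m n)"
      using lk unfolding Q_def tf by (simp add: divide_simps del: fact_Suc)
    finally show ?thesis by (simp add: m'_def)
  qed
  have "(\<Sum>n\<in>Poly_Mapping.keys m. raney (r + n) (m - Poly_Mapping.single n 1)) =
      Q * of_nat (\<Sum>n\<in>Poly_Mapping.keys m. (r + n) * Poly_Mapping.lookup m n)"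
    by (simp add: face sum_distrib_left)
  also have "(\<Sum>n\<in>Poly_Mapping.keys m. (r + n) * Poly_Mapping.lookup m n) = r * F_num m + E"
    by (simp add: E_def F_num_def edge_sum_def distrib_right sum.distrib sum_distrib_left)
  finally have faces: "(\<Sum>n\<in>Poly_Mapping.keys m. raney (r + n) (m - Poly_Mapping.single n 1)) =
      Q * of_nat (r * F_num m + E)" .
  have r0: "raney r m = Q * of_nat (r * Suc (r + P))"
    using False unfolding raney_def Q_def E_def[symmetric] P_def[symmetric]
    by (simp add: divide_simps del: of_nat_Suc mult_Suc_right)
  have "raney (Suc r) m = of_nat (Suc r) * fact (Suc (r + E - 1)) / (fact (Suc (r + P)) * of_nat (type_fact m))"
    using False E unfolding raney_def E_def[symmetric] P_def[symmetric] by simp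
  also have "\<dots> = Q * of_nat (Suc r * (r + E))"
    using E unfolding Q_def fact_Suc[of "r + E - 1"]
    by (simp add: ac_simps del: fact_Suc of_nat_Suc mult_Suc mult_Suc_right)
  also have "Suc r * (r + E) = r * Suc (r + P) + (r * F_num m + E)"
    by (simp add: EP algebra_simps)
  finally show ?thesis by (simp add: faces r0 distrib_left)
qed

section \<open>The series \<open>B\<^sub>r\<close> and their multiplicativity\<close>

definition raney_series :: "nat \<Rightarrow> series" where
  "raney_series r = mfps_sum (\<lambda>m. mfps_monom (type_monom m) (raney r m)) types"

lemma mfps_nth_raney_series:
  assumes "m \<in> types"
  shows "mfps_nth (raney_series r) (type_monom m) = raney r m"
proof -
  have "mfps_nth (raney_series r) (type_monom m) =
      (\<Sum>m'\<in>{m}. mfps_nth (mfps_monom (type_monom m') (raney r m')) (type_monom m))"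
    unfolding raney_series_def using assms inj_on_type_monom
    by (intro mfps_nth_sum_superset) (auto split: if_splits dest: inj_onD)
  then show ?thesis by simp
qed

lemma mfps_nth_raney_series_eq_0:
  "\<mu> \<notin> type_monom ` types \<Longrightarrow> mfps_nth (raney_series r) \<mu> = 0"
  unfolding raney_series_def mfps_sum_def by (auto intro!: sum.neutral)

text \<open>For \<open>m \<noteq> 0\<close> the factor \<open>r\<close> makes
  \<open>raney 0 m\<close> vanish.\<close>

lemma raney_series_0: "raney_series 0 = 1"
proof (rule mfps_eqI)
  fix \<mu>
  have 0: "0 \<in> types" "type_monom 0 = 0" by (simp_all add: types_def type_monom_def F_num_def)
  show "mfps_nth (raney_series 0) \<mu> = mfps_nth 1 \<mu>"
  proof (cases "\<mu> \<in> type_monom ` types")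
    case True
    then obtain m where m: "m \<in> types" "\<mu> = type_monom m" by blast
    then have "\<mu> = 0 \<longleftrightarrow> m = 0" using 0 inj_on_type_monom by (metis inj_onD)
    with m show ?thesis by (simp add: mfps_nth_raney_series raney_def)
  next
    case False
    with 0 have "\<mu> \<noteq> 0" by force
    with False show ?thesis by (simp add: mfps_nth_raney_series_eq_0)
  qed
qed

text \<open>By injectivity of \<open>type_monom\<close>, the face term of \<open>n\<close>
  contributes at \<open>type_monom m\<close> the Raney number of \<open>m\<close> less one face
  \<open>n\<close>, so \<open>raney_Suc\<close> applies; off the image of \<open>types\<close> every
  coefficient vanishes.\<close>

lemma raney_series_Suc:
  "raney_series (Suc r) = raney_series r + face_sum (\<lambda>n. raney_series (r + n))"
proof (rule mfps_eqI)
  fix \<mu>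
  let ?T = "\<lambda>n. mfps_monom (face_monom n) 1 * raney_series (r + n)"
  have div: "\<exists>m'\<in>types. \<mu> = type_monom (m' + Poly_Mapping.single n 1)"
    if nz: "mfps_nth (?T n) \<mu> \<noteq> 0" for n
  proof -
    from nz obtain \<nu> where \<nu>: "\<mu> = face_monom n + \<nu>" by (rule mfps_nth_monom_mult_nonzero)
    with nz have "\<nu> \<in> type_monom ` types"
      using mfps_nth_raney_series_eq_0 by (force simp: mfps_nth_monom_mult_add)
    with \<nu> show ?thesis by (auto simp: type_monom_add add.commute)
  qed
  show "mfps_nth (raney_series (Suc r)) \<mu> =
      mfps_nth (raney_series r + face_sum (\<lambda>n. raney_series (r + n))) \<mu>"
  proof (cases "\<mu> \<in> type_monom ` types")
    case False
    have "mfps_nth (?T n) \<mu> = 0" if "n \<ge> 2" for n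
      using div[of n] False types_add single_in_types[OF that] by blast
    then have "mfps_nth (mfps_sum ?T {2..}) \<mu> = 0"
      unfolding mfps_sum_def by (auto intro!: sum.neutral)
    with False show ?thesis by (simp add: mfps_nth_raney_series_eq_0)
  next
    case True
    then obtain m where m: "m \<in> types" "\<mu> = type_monom m" by blast
    have supp: "n \<in> Poly_Mapping.keys m" if n: "n \<in> {2..}" "mfps_nth (?T n) \<mu> \<noteq> 0" for n
    proof -
      from div[OF n(2)] obtain m' where "m' \<in> types" "\<mu> = type_monom (m' + Poly_Mapping.single n 1)"
        by blast
      then have "m = m' + Poly_Mapping.single n 1"
        using m n inj_on_type_monom types_add single_in_types by (metis atLeast_iff inj_onD)
      then show ?thesis by (simp add: in_keys_iff lookup_add)
    qed
    have coeff: "mfps_nth (?T n) \<mu> = raney (r + n) (m - Poly_Mapping.single n 1)"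
      if n: "n \<in> Poly_Mapping.keys m" for n
    proof -
      define m' where "m' = m - Poly_Mapping.single n 1"
      have m_eq: "m = Poly_Mapping.single n 1 + m'"
        using n by (intro poly_mapping_eqI)
          (auto simp: m'_def lookup_add lookup_minus lookup_single when_def in_keys_iff)
      have "Poly_Mapping.keys m' \<subseteq> Poly_Mapping.keys m"
        by (auto simp: m'_def in_keys_iff lookup_minus)
      then have "m' \<in> types" using m(1) by (auto simp: types_def)
      moreover have "\<mu> = face_monom n + type_monom m'"
        unfolding m(2) by (subst m_eq) (rule type_monom_add)
      ultimately show ?thesis
        by (simp add: mfps_nth_monom_mult_add mfps_nth_raney_series flip: m'_def)
    qed
    have "mfps_nth (mfps_sum ?T {2..}) \<mu> = (\<Sum>n\<in>Poly_Mapping.keys m. mfps_nth (?T n) \<mu>)"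
      using m(1) supp by (intro mfps_nth_sum_superset) (auto simp: types_def)
    also have "\<dots> = (\<Sum>n\<in>Poly_Mapping.keys m. raney (r + n) (m - Poly_Mapping.single n 1))"
      using coeff by (rule sum.cong[OF refl])
    finally show ?thesis using m by (simp add: mfps_nth_raney_series raney_Suc)
  qed
qed

lemma raney_series_add: "raney_series (r + s) = raney_series r * raney_series s"
proof -
  \<comment> \<open>With \<open>s\<close> fixed, the recurrence is linear in the sequence, hence
    inherited by the difference of two solutions.\<close>
  define D where "D r = raney_series r * raney_series s - raney_series (r + s)" for r
  have "D (Suc r) = D r + face_sum (\<lambda>n. D (r + n))" for r
  proof -
    have "raney_series (Suc r) * raney_series s = raney_series r * raney_series s +
        face_sum (\<lambda>n. raney_series (r + n) * raney_series s)"
      by (simp add: raney_series_Suc distrib_right mfps_sum_mult_right[OF face_summable] mult.assoc)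
    moreover have "raney_series (Suc r + s) =
        raney_series (r + s) + face_sum (\<lambda>n. raney_series (r + n + s))"
      by (simp add: raney_series_Suc ac_simps)
    moreover have "face_sum (\<lambda>n. D (r + n)) =
        face_sum (\<lambda>n. raney_series (r + n) * raney_series s) - face_sum (\<lambda>n. raney_series (r + n + s))"
      unfolding D_def right_diff_distrib by (rule mfps_sum_diff[OF face_summable face_summable])
    ultimately show ?thesis by (simp add: D_def)
  qed
  moreover have "D 0 = 0" by (simp add: D_def raney_series_0)
  ultimately have "D r = 0" by (rule face_recurrence_zero[rotated])
  then show ?thesis by (simp add: D_def)
qed

lemma raney_series_eq_power: "raney_series r = raney_series 1 ^ r"
proof (induction r)
  case (Suc r)
  then show ?case using raney_series_add[of 1 r] by (simp add: One_nat_def)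
qed (simp add: raney_series_0)

section \<open>Identification with \<beta> and conclusion\<close>

lemma beta_eq_raney_series: "beta = raney_series 1"
proof -
  have "beta_term m = mfps_monom (type_monom m) (raney 1 m)" for m
  proof -
    \<comment> \<open>The offsets match at \<open>r = 1\<close>: the factorials in
      \<open>raney 1 m\<close> are those of \<open>E_num m - 1\<close> and
      \<open>V_num m - 1\<close>, so it equals \<open>hyper_catalan m\<close>.\<close>
    have "E_num m - 1 = edge_sum m" "V_num m - 2 = vertex_sum m" "V_num m - 1 = 1 + vertex_sum m"
      by (simp_all add: E_num_def V_num_def edge_sum_def vertex_sum_def)
    then show ?thesis
      by (simp add: beta_term_def v_var_def e_var_def f_var_def mfps_const_def mfps_var_power
          t_pow_monom mfps_monom_mult type_monom_def hyper_catalan_def raney_pos_index del: fact_Suc)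
  qed
  then have "beta_term = (\<lambda>m. mfps_monom (type_monom m) (raney 1 m))" by (rule ext)
  then show ?thesis by (simp add: beta_def raney_series_def)
qed

lemma h_term_eq_face: "h_term \<alpha> n = mfps_monom (face_monom n) 1 * \<alpha> ^ n"
proof -
  have "mfps_monom (face_monom n) (1::rat) = t_var n * v_var ^ (n - 1) * e_var ^ n * mfps_var FVar ^ 1"
    unfolding t_var_def v_var_def e_var_def mfps_var_power
    by (simp add: mfps_var_def mfps_monom_mult type_monom_def ac_simps)
  then show ?thesis by (simp add: h_term_def f_var_def)
qed

theorem theorem1:
  shows "h beta = 0"
proof -
  \<comment> \<open>The powers of \<beta> in the face terms become \<open>raney_series n\<close>,
    which leaves an identity linear in these series.\<close>
  have "h beta = 1 - raney_series 1 + face_sum raney_series"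
    by (simp only: h_def h_term_eq_face[abs_def] beta_eq_raney_series flip: raney_series_eq_power)
  also have "\<dots> = 0"
    using raney_series_Suc[of 0] by (simp add: raney_series_0 flip: One_nat_def)
  finally show ?thesis .
qed

end
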